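(* Fix $W\in\mathbb{R}^{o\times d}$ and $\theta\in\Theta$, and assume $\beta=0$ and $W\notin\arg\min_{\tilde W}\mathcal{L}(\tilde W,\theta)$. Then there is a categorical distribution $\mathbb{P}$ over the (non-zero) singular values $\sigma$ of $\phi_\theta(X)$, independent of $\eta$, such that for every learning rate $\eta>0$, with $W_{GD}:=W-\eta\nabla_W\mathcal{L}(W,\theta)$ and $W_{CF}:=W^\star(\theta)$, $$\frac{\mathcal{L}(W,\theta)-\mathcal{L}(W_{GD},\theta)}{\mathcal{L}(W,\theta)-\mathcal{L}(W_{CF},\theta)}\le\left(1+\frac{\operatorname{Var}_{\mathbb{P}}(\sigma^2)}{\mathbb{E}_{\mathbb{P}}[\sigma^2]^2}\right)^{-1}\le 1.$$ Moreover, writing $\phi_\theta(X)=U\Sigma V^\top$ for its (compact) singular value decomposition, if all the singular values $\Sigma_{ii}$ are distinct then $\mathbb{P}$ is given by $$\mathbb{P}(\sigma=\Sigma_{ii})=\frac{\|((W\phi_\theta(X)-Y)V)_{\cdot i}\|^2}{\|(W\phi_\theta(X)-Y)V\|_F^2},$$ where $(\cdot)_{\cdot i}$ denotes the $i$-th column.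
   Context: Let $\mathcal{X}$ be a set, $\Theta\subset\mathbb{R}^N$ a parameter set, and $\phi_\theta:\mathcal{X}\to\mathbb{R}^d$ a feature map for each $\theta\in\Theta$. Let $(x_i,y_i)\in\mathcal{X}\times\mathbb{R}^o$, $i=1,\dots,n$, be data, $Y=(y_1,\dots,y_n)\in\mathbb{R}^{o\times n}$, and $\phi_\theta(X)\in\mathbb{R}^{d\times n}$ the matrix with columns $\phi_\theta(x_i)$. With $\beta=0$ the loss is $\mathcal{L}(W,\theta)=\sum_{i=1}^n\|y_i-W\phi_\theta(x_i)\|_2^2=\|Y-W\phi_\theta(X)\|_F^2$, where $\|\cdot\|_F$ is the Frobenius norm and $\nabla_W\mathcal{L}$ is the gradient in $W$ for the Frobenius inner product. $W^\star(\theta)$ denotes a minimizer of $W\mapsto\mathcal{L}(W,\theta)$ over $\mathbb{R}^{o\times d}$; it may be non-unique, and any choice gives the same value $\mathcal{L}(W^\star(\theta),\theta)$. The compact singular value decomposition is $\phi_\theta(X)=U\Sigma V^\top$ with $r=\operatorname{rank}\phi_\theta(X)$, $U\in\mathbb{R}^{d\times r}$ and $V\in\mathbb{R}^{n\times r}$ having orthonormal columns, and $\Sigma\in\mathbb{R}^{r\times r}$ diagonal with positive diagonal entries. *)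

theory Defs
  imports "HOL-Probability.Probability"
begin

text \<open>
  Matrices in \<open>\<real>\<^sup>m\<^sup>\<times>\<^sup>k\<close> are elements of \<open>real ^ 'k ^ 'm\<close>. The library's \<open>norm\<close> and \<open>inner\<close> on this
  type are the Frobenius norm and the Frobenius inner product.
\<close>

definition feature_matrix ::
  "('t \<Rightarrow> 'x \<Rightarrow> real ^ 'd) \<Rightarrow> ('n \<Rightarrow> 'x) \<Rightarrow> 't \<Rightarrow> real ^ 'n ^ 'd" where
  "feature_matrix \<phi> x \<theta> = (\<chi> k i. \<phi> \<theta> (x i) $ k)"

definition label_matrix :: "('n \<Rightarrow> real ^ 'o) \<Rightarrow> real ^ 'n ^ 'o" where
  "label_matrix y = (\<chi> k i. y i $ k)"

definition loss ::
  "('t \<Rightarrow> 'x \<Rightarrow> real ^ 'd) \<Rightarrow> ('n::finite \<Rightarrow> 'x) \<Rightarrow> ('n \<Rightarrow> real ^ 'o)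
    \<Rightarrow> real ^ 'd ^ 'o \<Rightarrow> 't \<Rightarrow> real" where
  "loss \<phi> x y W \<theta> = (\<Sum>i\<in>UNIV. (norm (y i - W *v \<phi> \<theta> (x i)))\<^sup>2)"

definition gradient :: "('a::real_inner \<Rightarrow> real) \<Rightarrow> 'a \<Rightarrow> 'a" where
  "gradient f a = (THE D. GDERIV f a :> D)"

definition nonzero_singular_values :: "real ^ 'n ^ 'd \<Rightarrow> real set" where
  "nonzero_singular_values A =
    {\<sigma>. \<sigma> > 0 \<and> (\<exists>v. v \<noteq> 0 \<and> (transpose A ** A) *v v = \<sigma>\<^sup>2 *\<^sub>R v)}"

text \<open>
  The index type \<open>'r\<close> has as many elements as the rank of \<open>A\<close>, hence is only available for \<open>A \<noteq> 0\<close>.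
  The singular values above are those on the diagonal of \<open>S\<close>; see
  \<open>nonzero_singular_values_svd\<close> below.
\<close>

definition compact_svd ::
  "real ^ 'n ^ 'd \<Rightarrow> real ^ 'r ^ 'd \<Rightarrow> real ^ 'r ^ 'r \<Rightarrow> real ^ 'r ^ 'n \<Rightarrow> bool" where
  "compact_svd A U S V \<longleftrightarrow>
    CARD('r) = rank A \<and>
    transpose U ** U = mat 1 \<and> transpose V ** V = mat 1 \<and>
    (\<forall>i j. i \<noteq> j \<longrightarrow> S $ i $ j = 0) \<and> (\<forall>i. S $ i $ i > 0) \<and>
    A = U ** S ** transpose V"

lemma inner_matrix_mult_left:
  fixes B :: "real ^ 'n ^ 'd" and H :: "real ^ 'd ^ 'o" and M :: "real ^ 'n ^ 'o"
  shows "(H ** B) \<bullet> M = H \<bullet> (M ** transpose B)"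
proof -
  have "(\<Sum>j\<in>UNIV. (\<Sum>k\<in>UNIV. H$i$k * B$k$j) * M$i$j) =
      (\<Sum>k\<in>UNIV. H$i$k * (\<Sum>j\<in>UNIV. M$i$j * B$k$j))" for i
    unfolding sum_distrib_left sum_distrib_right
    by (subst sum.swap) (simp only: mult_ac)
  then show ?thesis
    by (simp add: inner_vec_def matrix_matrix_mult_def transpose_def)
qed

lemma bounded_linear_matrix_mult_left:
  fixes B :: "real ^ 'n ^ 'd"
  shows "bounded_linear (\<lambda>H :: real ^ 'd ^ 'o. H ** B)"
  unfolding linear_conv_bounded_linear[symmetric]
  by (rule linearI) (simp_all add: vec_eq_iff matrix_matrix_mult_def
      distrib_right sum.distrib sum_distrib_left mult.assoc)

lemma norm_power2_eq_sum_columns: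
  fixes M :: "real ^ 'n ^ 'm"
  shows "(norm M)\<^sup>2 = (\<Sum>i\<in>UNIV. (norm (column i M))\<^sup>2)"
  unfolding power2_norm_eq_inner inner_vec_def column_def
  by (subst sum.swap) simp

lemma loss_eq_frobenius:
  "loss \<phi> x y W \<theta> = (norm (label_matrix y - W ** feature_matrix \<phi> x \<theta>))\<^sup>2"
proof -
  have "column i (label_matrix y - W ** feature_matrix \<phi> x \<theta>) = y i - W *v \<phi> \<theta> (x i)" for i
    by (simp add: vec_eq_iff column_def label_matrix_def feature_matrix_def
        matrix_matrix_mult_def matrix_vector_mult_def)
  then show ?thesis
    by (simp add: loss_def norm_power2_eq_sum_columns)
qed

lemma loss_minimizer_exists: "\<exists>W. is_arg_min (\<lambda>W. loss \<phi> x y W \<theta>) (\<lambda>_. True) W"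
proof -
  let ?A = "feature_matrix \<phi> x \<theta>"
  let ?S = "range (\<lambda>W. W ** ?A)"
  have "closed ?S"
    by (intro closed_subspace linear_subspace_image subspace_UNIV
        bounded_linear.linear bounded_linear_matrix_mult_left)
  then obtain B where "B \<in> ?S" and *: "\<And>C. C \<in> ?S \<Longrightarrow> dist (label_matrix y) B \<le> dist (label_matrix y) C"
    using distance_attains_inf[of ?S "label_matrix y"] by blast
  then obtain W where W: "B = W ** ?A" by blast
  have "loss \<phi> x y W \<theta> \<le> loss \<phi> x y W' \<theta>" for W'
    using *[of "W' ** ?A"] W unfolding loss_eq_frobenius dist_norm
    by (intro power_mono) auto
  then show ?thesis
    unfolding is_arg_min_def not_less[symmetric] by blast
qed

lemma gradient_eqI: "GDERIV f a :> D \<Longrightarrow> gradient f a = D"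
  unfolding gradient_def
proof (rule the_equality)
  fix E assume "GDERIV f a :> D" "GDERIV f a :> E"
  then have "(\<lambda>h. inner h D) = (\<lambda>h. inner h E)"
    unfolding gderiv_def by (rule has_derivative_unique)
  then have "\<forall>h. inner h E = inner h D"
    by metis
  then show "E = D"
    by (simp only: vector_eq_ldot)
qed

lemma gradient_loss:
  fixes \<phi> :: "'t \<Rightarrow> 'x \<Rightarrow> real ^ 'd"
  shows "gradient (\<lambda>W. loss \<phi> x y W \<theta>) W =
    2 *\<^sub>R ((W ** feature_matrix \<phi> x \<theta> - label_matrix y) ** transpose (feature_matrix \<phi> x \<theta>))"
proof (rule gradient_eqI)
  let ?A = "feature_matrix \<phi> x \<theta>" and ?Y = "label_matrix y"
  note d = bounded_linear.has_derivative[OF bounded_linear_matrix_mult_left has_derivative_ident]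
  have "((\<lambda>W. (W ** ?A - ?Y) \<bullet> (W ** ?A - ?Y)) has_derivative
      (\<lambda>H. (W ** ?A - ?Y) \<bullet> (H ** ?A - 0) + (H ** ?A - 0) \<bullet> (W ** ?A - ?Y))) (at W)"
    by (intro has_derivative_inner has_derivative_diff d has_derivative_const)
  moreover have "loss \<phi> x y W \<theta> = (W ** ?A - ?Y) \<bullet> (W ** ?A - ?Y)" for W
    by (simp add: loss_eq_frobenius norm_minus_commute flip: power2_norm_eq_inner)
  moreover have "(W ** ?A - ?Y) \<bullet> (H ** ?A - 0) + (H ** ?A - 0) \<bullet> (W ** ?A - ?Y) =
      H \<bullet> (2 *\<^sub>R ((W ** ?A - ?Y) ** transpose ?A))" for H
    by (simp add: inner_commute[of "W ** ?A - ?Y"] inner_matrix_mult_left)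
  ultimately show "GDERIV (\<lambda>W. loss \<phi> x y W \<theta>) W :> 2 *\<^sub>R ((W ** ?A - ?Y) ** transpose ?A)"
    unfolding gderiv_def by simp
qed

lemma nonzero_singular_values_svd:
  fixes A :: "real ^ 'n ^ 'd" and S :: "real ^ 'r ^ 'r"
  assumes "compact_svd A U S V"
  shows "nonzero_singular_values A = range (\<lambda>i. S $ i $ i)"
proof -
  from assms have UU: "transpose U ** U = mat 1" and VV: "transpose V ** V = mat 1"
    and off: "\<And>i j. i \<noteq> j \<Longrightarrow> S $ i $ j = 0" and pos: "\<And>i. S $ i $ i > 0"
    and A: "A = U ** S ** transpose V"
    unfolding compact_svd_def by auto
  have S_eq: "S $ i $ j = (if j = i then S $ i $ i else 0)" for i j
    using off by auto
  have S_vec: "(S *v w) $ i = S $ i $ i * w $ i" for w i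
    unfolding matrix_vector_mult_def vec_lambda_beta
    by (subst S_eq) (simp add: if_distrib[of "\<lambda>t. t * _"] cong: if_cong)
  have ST: "transpose S = S"
    unfolding vec_eq_iff transpose_def using S_eq by (metis vec_lambda_beta)
  have "transpose A = V ** S ** transpose U"
    unfolding A matrix_transpose_mul transpose_transpose ST by (simp only: matrix_mul_assoc)
  then have "transpose A ** A = V ** S ** (transpose U ** U) ** S ** transpose V"
    unfolding A by (simp only: matrix_mul_assoc)
  then have AA: "(transpose A ** A) *v v = V *v (S *v (S *v (transpose V *v v)))" for v
    by (simp only: UU matrix_mul_rid matrix_vector_mul_assoc matrix_mul_assoc)
  have VTV: "transpose V *v (V *v w) = w" for w
    by (simp only: matrix_vector_mul_assoc VV matrix_vector_mul_lid)
  show ?thesis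
  proof (intro equalityI subsetI)
    fix \<sigma> assume "\<sigma> \<in> nonzero_singular_values A"
    then obtain v where "\<sigma> > 0" "v \<noteq> 0" and v: "V *v (S *v (S *v (transpose V *v v))) = \<sigma>\<^sup>2 *\<^sub>R v"
      unfolding nonzero_singular_values_def AA by auto
    define w where "w = transpose V *v v"
    have "w \<noteq> 0"
      using v \<open>\<sigma> > 0\<close> \<open>v \<noteq> 0\<close> unfolding w_def[symmetric] by auto
    then obtain i where i: "w $ i \<noteq> 0"
      by (auto simp: vec_eq_iff)
    have "S *v (S *v w) = \<sigma>\<^sup>2 *\<^sub>R w"
      using arg_cong[OF v, of "\<lambda>u. transpose V *v u"]
      by (simp add: VTV w_def matrix_vector_mult_scaleR del: transpose_matrix_vector)
    then have "(S *v (S *v w)) $ i = (\<sigma>\<^sup>2 *\<^sub>R w) $ i"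
      by simp
    then have "(S $ i $ i)\<^sup>2 = \<sigma>\<^sup>2"
      using i by (simp add: S_vec power2_eq_square)
    then have "\<sigma> = S $ i $ i"
      using pos[of i] \<open>\<sigma> > 0\<close> by (simp add: power2_eq_iff_nonneg less_imp_le)
    then show "\<sigma> \<in> range (\<lambda>i. S $ i $ i)"
      by blast
  next
    fix \<sigma> assume "\<sigma> \<in> range (\<lambda>i. S $ i $ i)"
    then obtain i where \<sigma>: "\<sigma> = S $ i $ i" by blast
    have e: "S *v axis i 1 = \<sigma> *\<^sub>R axis i 1"
      by (auto simp: vec_eq_iff S_vec \<sigma> axis_def)
    have "(transpose A ** A) *v (V *v axis i 1) = \<sigma>\<^sup>2 *\<^sub>R (V *v axis i 1)"
      by (simp add: AA VTV e matrix_vector_mult_scaleR power2_eq_square del: transpose_matrix_vector)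
    moreover have "V *v axis i 1 \<noteq> 0"
      by (metis VTV matrix_vector_mult_0_right axis_eq_0_iff zero_neq_one)
    ultimately show "\<sigma> \<in> nonzero_singular_values A"
      using pos[of i] unfolding nonzero_singular_values_def \<sigma> by blast
  qed
qed

end

theory Submission
  imports Defs
begin

text \<open>
  Let \<open>A\<close> be the feature matrix, \<open>R = W A - Y\<close> the residual and \<open>B\<close> an orthonormal eigenbasis of
  \<open>A\<^sup>T A\<close>, so that \<open>\<sigma>(b) = \<parallel>A b\<parallel>\<close> is the singular value belonging to \<open>b \<in> B\<close>. In this basis, with
  \<open>c(b) = \<parallel>R b\<parallel>\<^sup>2\<close>, one gradient step gains
  \<open>4 \<eta> \<Sum>\<sigma>\<^sup>2 c - 4 \<eta>\<^sup>2 \<Sum>\<sigma>\<^sup>4 c \<le> (\<Sum>\<sigma>\<^sup>2 c)\<^sup>2 / \<Sum>\<sigma>\<^sup>4 c\<close>, whereas the exact minimizer, whose residual vanishes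
  on all \<open>b\<close> with \<open>\<sigma>(b) \<noteq> 0\<close> and agrees with \<open>R\<close> on the others, gains \<open>M = \<Sum>c\<close> over \<open>\<sigma>(b) \<noteq> 0\<close>. For the
  law \<open>P\<close> of \<open>\<sigma>(b)\<close> when \<open>b\<close> has probability \<open>c(b) / M\<close>, the quotient is at most
  \<open>E[\<sigma>\<^sup>2]\<^sup>2 / E[\<sigma>\<^sup>4]\<close>. If the singular values are distinct, each \<open>b\<close> with \<open>\<sigma>(b) = \<Sigma>\<^sub>i\<^sub>i\<close> is \<open>\<plusminus>\<close> the
  \<open>i\<close>-th column of \<open>V\<close>.
\<close>

section \<open>Eigenbases of self-adjoint maps\<close>

text \<open>Divide by \<open>t\<close> and let \<open>t\<close> tend to 0. This is the first-order
  condition behind both extremal arguments below, for the Rayleigh quotient and for the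
  loss.\<close>

lemma linear_le_quadratic_imp_nonpos:
  fixes a b :: real
  assumes "\<And>t. t > 0 \<Longrightarrow> a * t \<le> b * t\<^sup>2"
  shows "a \<le> 0"
proof (rule ccontr)
  assume "\<not> a \<le> 0"
  \<comment> \<open>Small enough that \<open>(\<bar>b\<bar> + 1) * t\<close> is only
    \<open>a / 2\<close>; the 1 keeps the denominator positive.\<close>
  define t where "t = a / (\<bar>b\<bar> + 1) / 2"
  have "t > 0"
    using \<open>\<not> a \<le> 0\<close> by (simp add: t_def add_nonneg_pos)
  then have "a \<le> b * t"
    using assms[of t] by (simp add: power2_eq_square)
  also have "\<dots> \<le> (\<bar>b\<bar> + 1) * t"
    using \<open>t > 0\<close> by (intro mult_right_mono) auto
  also have "\<dots> = a / 2"
    by (simp add: t_def field_simps)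
  finally show False
    using \<open>\<not> a \<le> 0\<close> by simp
qed

text \<open>A maximizer \<open>v\<close> of the Rayleigh quotient is an eigenvector: otherwise the quotient grows to first
  order in the direction of \<open>u = f v - \<mu> v\<close>.\<close>

lemma selfadjoint_eigenvector_exists:
  fixes f :: "'a::euclidean_space \<Rightarrow> 'a"
  assumes f: "linear f" and sa: "\<And>x y. f x \<bullet> y = x \<bullet> f y"
    and S: "subspace S" "S \<noteq> {0}" "\<And>x. x \<in> S \<Longrightarrow> f x \<in> S"
  obtains v \<mu> where "v \<in> S" "norm v = 1" "f v = \<mu> *\<^sub>R v"
proof -
  let ?K = "S \<inter> sphere 0 1"
  have "compact ?K"
    using closed_subspace[OF S(1)] by (intro closed_Int_compact) auto
  moreover obtain z where z: "z \<in> S" "z \<noteq> 0"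
    using S(1,2) subspace_0 by blast
  then have "inverse (norm z) *\<^sub>R z \<in> ?K"
    using S(1) by (simp add: subspace_scale)
  then have "?K \<noteq> {}" by blast
  moreover have "continuous_on ?K (\<lambda>x. x \<bullet> f x)"
    using f by (intro continuous_intros linear_continuous_on)
      (simp add: linear_conv_bounded_linear)
  ultimately obtain v where v: "v \<in> ?K" and max: "\<And>x. x \<in> ?K \<Longrightarrow> x \<bullet> f x \<le> v \<bullet> f v"
    using continuous_attains_sup[of ?K "\<lambda>x. x \<bullet> f x"] by blast
  define \<mu> where "\<mu> = v \<bullet> f v"
  have vv: "v \<in> S" "norm v = 1" "v \<bullet> v = 1"
    using v by (auto simp: norm_eq_1)
  \<comment> \<open>By homogeneity the maximum over the unit sphere bounds the form on all of
    \<open>S\<close>, so that \<open>v + t *\<^sub>R u\<close> need not be normalized below.\<close>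
  have le: "x \<bullet> f x \<le> \<mu> * (x \<bullet> x)" if "x \<in> S" for x
  proof (cases "x = 0")
    case False
    have "inverse (norm x) *\<^sub>R x \<in> ?K"
      using False that S(1) by (simp add: subspace_scale)
    from max[OF this] have "inverse (norm x) * (inverse (norm x) * (x \<bullet> f x)) \<le> \<mu>"
      by (simp add: linear_scale[OF f] \<mu>_def)
    then have "(norm x * norm x) * (inverse (norm x) * (inverse (norm x) * (x \<bullet> f x))) \<le> (norm x * norm x) * \<mu>"
      by (intro mult_left_mono) auto
    moreover have "(norm x * norm x) * (inverse (norm x) * (inverse (norm x) * (x \<bullet> f x))) = x \<bullet> f x"
      using False by (simp add: field_simps)
    ultimately show ?thesis
      by (simp only: power2_norm_eq_inner flip: power2_eq_square) (simp only: mult.commute)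
  qed simp
  define u where "u = f v - \<mu> *\<^sub>R v"
  have u: "u \<in> S"
    unfolding u_def using S vv(1) by (intro subspace_diff subspace_scale) auto
  have uv: "u \<bullet> v = 0"
    unfolding inner_commute[of u v] by (simp add: u_def inner_diff_right vv(3) \<mu>_def)
  moreover have "u \<bullet> u = u \<bullet> f v - \<mu> * (u \<bullet> v)"
    by (subst (2) u_def) (simp add: inner_diff_right)
  ultimately have ufv: "u \<bullet> f v = u \<bullet> u"
    by simp
  \<comment> \<open>On the left of \<open>le\<close> at \<open>v + t *\<^sub>R u\<close> both cross
    terms equal \<open>u \<bullet> u\<close>; on the right \<open>u \<bullet> v = 0\<close> leaves
    no linear term.\<close>
  have "2 * (u \<bullet> u) \<le> 0"
  proof (rule linear_le_quadratic_imp_nonpos)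
    fix t :: real assume "t > 0"
    have "(v + t *\<^sub>R u) \<bullet> f (v + t *\<^sub>R u) \<le> \<mu> * ((v + t *\<^sub>R u) \<bullet> (v + t *\<^sub>R u))"
      using vv(1) u S(1) by (intro le subspace_add subspace_scale) auto
    moreover have "v \<bullet> f u = u \<bullet> u"
      using sa[of v u] ufv by (simp add: inner_commute)
    ultimately show "2 * (u \<bullet> u) * t \<le> (\<mu> * (u \<bullet> u) - u \<bullet> f u) * t\<^sup>2"
      using uv ufv by (simp add: linear_add[OF f] linear_scale[OF f] inner_add_left inner_add_right
          inner_commute[of v u] vv(3) \<mu>_def[symmetric] algebra_simps power2_eq_square)
  qed
  then have "u \<bullet> u = 0"
    using inner_ge_zero[of u] by linarith
  then have "u = 0"
    by simp
  then show thesis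
    using that vv(1,2) by (simp add: u_def)
qed

definition orthonormal_basis :: "'a::euclidean_space set \<Rightarrow> bool" where
  "orthonormal_basis B \<longleftrightarrow> pairwise orthogonal B \<and> (\<forall>b\<in>B. norm b = 1) \<and> span B = UNIV"

text \<open>An orthonormal set of eigenvectors of maximal size spans, since its orthogonal complement is
  invariant and would otherwise contain a further eigenvector.\<close>

lemma selfadjoint_eigenbasis_exists:
  fixes f :: "'a::euclidean_space \<Rightarrow> 'a"
  assumes f: "linear f" and sa: "\<And>x y. f x \<bullet> y = x \<bullet> f y"
  obtains B where "orthonormal_basis B" "\<And>b. b \<in> B \<Longrightarrow> \<exists>\<mu>. f b = \<mu> *\<^sub>R b"
proof -
  define ok where "ok B \<longleftrightarrow> pairwise orthogonal B \<and> (\<forall>b\<in>B. norm b = 1 \<and> (\<exists>\<mu>. f b = \<mu> *\<^sub>R b))" for B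
  have bound: "finite B \<and> card B \<le> DIM('a)" if "ok B" for B
  proof -
    have "independent B"
      using that unfolding ok_def by (intro pairwise_orthogonal_independent) auto
    then show ?thesis
      using independent_bound by blast
  qed
  have "ok {}"
    by (simp add: ok_def pairwise_def)
  with bound obtain B where B: "ok B" and max: "\<And>C. ok C \<Longrightarrow> card C \<le> card B"
    using ex_has_greatest_nat[of ok "{}" card "Suc DIM('a)"] by (auto simp: less_Suc_eq_le)
  define S where "S = {x. \<forall>b\<in>B. orthogonal b x}"
  have "subspace S"
    unfolding S_def by (rule subspace_orthogonal_to_vectors)
  have inv: "f x \<in> S" if "x \<in> S" for x
    unfolding S_def
  proof safe
    fix b assume "b \<in> B"
    then obtain \<mu> where "f b = \<mu> *\<^sub>R b"
      using B by (auto simp: ok_def)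
    then have "b \<bullet> f x = \<mu> * (b \<bullet> x)"
      by (simp flip: sa)
    then show "orthogonal b (f x)"
      using that \<open>b \<in> B\<close> by (simp add: S_def orthogonal_def)
  qed
  have "S = {0}"
  proof (rule ccontr)
    assume "S \<noteq> {0}"
    then obtain v \<mu> where v: "v \<in> S" "norm v = 1" "f v = \<mu> *\<^sub>R v"
      using selfadjoint_eigenvector_exists[OF f sa \<open>subspace S\<close>] inv by blast
    have "ok (insert v B)"
      using B v by (auto simp: ok_def S_def pairwise_insert orthogonal_commute)
    moreover have "v \<notin> B"
      using v by (auto simp: S_def orthogonal_def norm_eq_1)
    ultimately show False
      using max[of "insert v B"] bound[OF B] by simp
  qed
  have "span B = UNIV"
  proof (rule ccontr)
    assume "span B \<noteq> UNIV"
    then have "span B \<subset> span (UNIV :: 'a set)"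
      by auto
    then obtain x where "x \<noteq> 0" "\<And>y. y \<in> span B \<Longrightarrow> orthogonal x y"
      by (rule orthogonal_to_subspace_exists_gen) blast
    then have "x \<in> S"
      by (auto simp: S_def span_base orthogonal_commute)
    with \<open>x \<noteq> 0\<close> \<open>S = {0}\<close> show False by simp
  qed
  with B that[of B] show thesis
    by (auto simp: ok_def orthonormal_basis_def)
qed

section \<open>Orthonormal bases and right singular vectors\<close>

lemma orthonormal_basis_finite: "orthonormal_basis B \<Longrightarrow> finite B"
  unfolding orthonormal_basis_def
  by (intro independent_imp_finite pairwise_orthogonal_independent) auto

lemma inner_orthonormal_basis:
  assumes "orthonormal_basis B"
  shows "x \<bullet> y = (\<Sum>b\<in>B. (x \<bullet> b) * (y \<bullet> b))"
proof -
  have "(\<Sum>b\<in>B. (x \<bullet> b) *\<^sub>R b) = x"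
    using assms orthonormal_basis_finite[OF assms]
    by (intro orthonormal_basis_expand) (auto simp: orthonormal_basis_def)
  then have "x \<bullet> y = (\<Sum>b\<in>B. (x \<bullet> b) *\<^sub>R b) \<bullet> y"
    by simp
  then show ?thesis
    by (simp add: inner_sum_left inner_commute[of y])
qed

text \<open>Parseval's identity for each row. It reduces Frobenius norms to the action on basis
  vectors, where all matrices in question are easy to evaluate.\<close>

lemma inner_matrix_orthonormal_basis:
  fixes M N :: "real ^ 'n ^ 'm"
  assumes "orthonormal_basis B"
  shows "M \<bullet> N = (\<Sum>b\<in>B. (M *v b) \<bullet> (N *v b))"
proof -
  have "M \<bullet> N = (\<Sum>i\<in>UNIV. \<Sum>b\<in>B. (M $ i \<bullet> b) * (N $ i \<bullet> b))"
    unfolding inner_vec_def[of M N] by (intro sum.cong refl inner_orthonormal_basis[OF assms])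
  also have "\<dots> = (\<Sum>b\<in>B. \<Sum>i\<in>UNIV. (M $ i \<bullet> b) * (N $ i \<bullet> b))"
    by (rule sum.swap)
  also have "\<dots> = (\<Sum>b\<in>B. (M *v b) \<bullet> (N *v b))"
    by (simp add: matrix_mult_dot inner_vec_def[of "vec_lambda _"])
  finally show ?thesis .
qed

lemma inner_transpose_mult:
  fixes A :: "real ^ 'n ^ 'd"
  shows "((transpose A ** A) *v x) \<bullet> y = (A *v x) \<bullet> (A *v y)"
proof -
  have "((transpose A ** A) *v x) \<bullet> y = ((A *v x) v* A) \<bullet> y"
    by (simp flip: matrix_vector_mul_assoc)
  then show ?thesis
    by (simp only: dot_lmul_matrix)
qed

text \<open>Pairing the eigenvalue equation of \<open>transpose A ** A\<close> with the unit vector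
  \<open>b\<close> itself forces the eigenvalue to be
  \<open>(norm (A *v b))\<^sup>2\<close>.\<close>

lemma right_singular_basis_exists:
  fixes A :: "real ^ 'n ^ 'd"
  obtains B where "orthonormal_basis B"
    "\<And>b. b \<in> B \<Longrightarrow> (transpose A ** A) *v b = (norm (A *v b))\<^sup>2 *\<^sub>R b"
proof -
  obtain B where B: "orthonormal_basis B"
    and ev: "\<And>b. b \<in> B \<Longrightarrow> \<exists>\<mu>. (transpose A ** A) *v b = \<mu> *\<^sub>R b"
  proof (rule selfadjoint_eigenbasis_exists[of "(*v) (transpose A ** A)"])
    show "linear ((*v) (transpose A ** A))"
      by (rule matrix_vector_mul_linear)
    show "((transpose A ** A) *v x) \<bullet> y = x \<bullet> ((transpose A ** A) *v y)" for x y
      unfolding inner_commute[of x] inner_transpose_mult by (rule inner_commute)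
  qed blast
  have "(transpose A ** A) *v b = (norm (A *v b))\<^sup>2 *\<^sub>R b" if b: "b \<in> B" for b
  proof -
    obtain \<mu> where \<mu>: "(transpose A ** A) *v b = \<mu> *\<^sub>R b"
      using ev[OF b] by blast
    have "b \<bullet> b = 1"
      using B b by (simp add: orthonormal_basis_def norm_eq_1)
    then have "\<mu> = (norm (A *v b))\<^sup>2"
      using inner_transpose_mult[of A b b] \<mu> by (simp add: power2_norm_eq_inner)
    with \<mu> show ?thesis by simp
  qed
  with B that show thesis by blast
qed

lemma pmf_of_weights_exists:
  assumes "finite B" "\<And>b. b \<in> B \<Longrightarrow> w b \<ge> 0" "sum w B = (1::real)"
  obtains Q where "\<And>b. pmf Q b = (if b \<in> B then w b else 0)"
proof (rule that)
  fix b
  show "pmf (embed_pmf (\<lambda>b. if b \<in> B then w b else 0)) b = (if b \<in> B then w b else 0)"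
  proof (rule pmf_embed_pmf)
    have "(\<integral>\<^sup>+ b. ennreal (if b \<in> B then w b else 0) \<partial>count_space UNIV) =
        (\<Sum>b\<in>B. ennreal (w b))"
      using assms(1) by (subst nn_integral_count_space'[of B]) auto
    also have "\<dots> = 1"
      using assms by simp
    finally show "(\<integral>\<^sup>+ b. ennreal (if b \<in> B then w b else 0) \<partial>count_space UNIV) = 1" .
  qed (use assms in auto)
qed

section \<open>Singular values in the basis and in the compact SVD\<close>

text \<open>An eigenvector \<open>v\<close> has a nonzero coefficient at some
  \<open>b \<in> B\<close>. Evaluating \<open>(A *v v) \<bullet> (A *v b)\<close> through either
  eigenvalue equation shows that the two eigenvalues agree.\<close>

lemma nonzero_singular_values_basis:
  fixes A :: "real ^ 'n ^ 'd"
  assumes B: "orthonormal_basis B"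
    and ev: "\<And>b. b \<in> B \<Longrightarrow> (transpose A ** A) *v b = (norm (A *v b))\<^sup>2 *\<^sub>R b"
  shows "nonzero_singular_values A = (\<lambda>b. norm (A *v b)) ` {b \<in> B. A *v b \<noteq> 0}"
proof (intro equalityI subsetI)
  fix \<sigma> assume "\<sigma> \<in> nonzero_singular_values A"
  then obtain v where "\<sigma> > 0" "v \<noteq> 0" and v: "(transpose A ** A) *v v = \<sigma>\<^sup>2 *\<^sub>R v"
    unfolding nonzero_singular_values_def by blast
  have "\<exists>b\<in>B. v \<bullet> b \<noteq> 0"
  proof (rule ccontr)
    assume "\<not> (\<exists>b\<in>B. v \<bullet> b \<noteq> 0)"
    then have "v \<bullet> v = 0"
      by (subst inner_orthonormal_basis[OF B]) simp
    with \<open>v \<noteq> 0\<close> show False by simp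
  qed
  then obtain b where b: "b \<in> B" "v \<bullet> b \<noteq> 0" by blast
  have "\<sigma>\<^sup>2 * (v \<bullet> b) = (A *v v) \<bullet> (A *v b)"
    using inner_transpose_mult[of A v b] v by simp
  also have "\<dots> = (norm (A *v b))\<^sup>2 * (v \<bullet> b)"
    using inner_transpose_mult[of A b v] ev[OF b(1)] by (simp add: inner_commute)
  finally have "\<sigma> = norm (A *v b)"
    using b(2) \<open>\<sigma> > 0\<close> by (simp add: power2_eq_iff_nonneg)
  then show "\<sigma> \<in> (\<lambda>b. norm (A *v b)) ` {b \<in> B. A *v b \<noteq> 0}"
    using b(1) \<open>\<sigma> > 0\<close> by auto
next
  fix \<sigma> assume "\<sigma> \<in> (\<lambda>b. norm (A *v b)) ` {b \<in> B. A *v b \<noteq> 0}"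
  then obtain b where b: "b \<in> B" "A *v b \<noteq> 0" "\<sigma> = norm (A *v b)" by blast
  then have "b \<noteq> 0" by auto
  then show "\<sigma> \<in> nonzero_singular_values A"
    using b ev[OF b(1)] unfolding nonzero_singular_values_def by auto
qed

lemma column_matrix_mult:
  fixes R :: "real ^ 'n ^ 'm"
  shows "column i (R ** V) = R *v column i V"
  by (simp add: vec_eq_iff column_def matrix_matrix_mult_def matrix_vector_mult_def)

text \<open>Distinct singular values make the eigenspaces one-dimensional. This links a basis chosen
  without reference to the SVD to the columns of \<open>V\<close>, up to sign.\<close>

lemma compact_svd_unit_eigenvector:
  fixes A :: "real ^ 'n ^ 'd" and S :: "real ^ 'r ^ 'r"
  assumes svd: "compact_svd A U S V" and inj: "inj (\<lambda>i. S $ i $ i)"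
    and b: "norm b = 1" "(transpose A ** A) *v b = (S $ i $ i)\<^sup>2 *\<^sub>R b"
  obtains c where "\<bar>c\<bar> = 1" "b = c *\<^sub>R column i V"
proof -
  from svd have UU: "transpose U ** U = mat 1" and VV: "transpose V ** V = mat 1"
    and off: "\<And>i j. i \<noteq> j \<Longrightarrow> S $ i $ j = 0" and pos: "\<And>i. S $ i $ i > 0"
    and A: "A = U ** S ** transpose V"
    unfolding compact_svd_def by auto
  have S_eq: "S $ i $ j = (if j = i then S $ i $ i else 0)" for i j
    using off by auto
  have S_vec: "(S *v w) $ i = S $ i $ i * w $ i" for w i
    unfolding matrix_vector_mult_def vec_lambda_beta
    by (subst S_eq) (simp add: if_distrib[of "\<lambda>t. t * _"] cong: if_cong)
  have ST: "transpose S = S"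
    unfolding vec_eq_iff transpose_def using S_eq by (metis vec_lambda_beta)
  have "transpose A = V ** S ** transpose U"
    unfolding A matrix_transpose_mul transpose_transpose ST by (simp only: matrix_mul_assoc)
  then have "transpose A ** A = V ** S ** (transpose U ** U) ** S ** transpose V"
    unfolding A by (simp only: matrix_mul_assoc)
  then have AA: "(transpose A ** A) *v v = V *v (S *v (S *v (transpose V *v v)))" for v
    by (simp only: UU matrix_mul_rid matrix_vector_mul_assoc matrix_mul_assoc)
  have VTV: "transpose V *v (V *v w) = w" for w
    by (simp only: matrix_vector_mul_assoc VV matrix_vector_mul_lid)
  define w where "w = transpose V *v b"
  have eq: "V *v (S *v (S *v w)) = (S $ i $ i)\<^sup>2 *\<^sub>R b"
    using b(2) unfolding AA w_def .
  have "S *v (S *v w) = (S $ i $ i)\<^sup>2 *\<^sub>R w"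
    using arg_cong[OF eq, of "\<lambda>u. transpose V *v u"]
    by (simp add: VTV w_def matrix_vector_mult_scaleR del: transpose_matrix_vector)
  then have "(S $ j $ j)\<^sup>2 * w $ j = (S $ i $ i)\<^sup>2 * w $ j" for j
    by (simp add: vec_eq_iff S_vec power2_eq_square mult.assoc)
  moreover have "S $ j $ j \<noteq> S $ i $ i" if "j \<noteq> i" for j
    using inj that by (auto dest: injD)
  ultimately have w0: "w $ j = 0" if "j \<noteq> i" for j
    using that pos[of i] pos[of j] by (metis mult_right_cancel power2_eq_imp_eq less_imp_le)
  have "(S *v (S *v w)) $ j = ((S $ i $ i)\<^sup>2 *\<^sub>R (w $ i *\<^sub>R axis i 1)) $ j" for j
    by (cases "j = i") (simp_all add: S_vec w0 axis_def power2_eq_square)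
  then have "S *v (S *v w) = (S $ i $ i)\<^sup>2 *\<^sub>R (w $ i *\<^sub>R axis i 1)"
    by (subst vec_eq_iff) blast
  \<comment> \<open>Since \<open>V\<close> need not be square, \<open>b = V *v w\<close> is not
    immediate from the definition of \<open>w\<close>; it is the eigenvalue equation
    \<open>eq\<close> that places \<open>b\<close> in the range of \<open>V\<close>.\<close>
  then have "(S $ i $ i)\<^sup>2 *\<^sub>R b = (S $ i $ i)\<^sup>2 *\<^sub>R (w $ i *\<^sub>R column i V)"
    using eq by (simp add: matrix_vector_mult_scaleR matrix_vector_mul_component matrix_vector_mult_basis)
  then have bc: "b = w $ i *\<^sub>R column i V"
    using pos[of i] by (simp only: scaleR_cancel_left) simp
  have "column i V \<bullet> column i V = (transpose V ** V) $ i $ i"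
    by (simp add: matrix_matrix_mult_def transpose_def column_def inner_vec_def)
  then have "norm (column i V) = 1"
    by (simp add: VV norm_eq_1 mat_def)
  then have "\<bar>w $ i\<bar> = 1"
    using arg_cong[OF bc, of norm] b(1) by simp
  with bc that show thesis by blast
qed

section \<open>Gains of a gradient step and of the exact minimizer\<close>

lemma inner_gradient_direction:
  fixes R :: "real ^ 'n ^ 'o" and A :: "real ^ 'n ^ 'd"
  shows "R \<bullet> (R ** transpose A ** A) = (norm (R ** transpose A))\<^sup>2"
  unfolding power2_norm_eq_inner inner_commute[of R] by (rule inner_matrix_mult_left)

text \<open>The gradient is \<open>2 *\<^sub>R (R W ** transpose A)\<close>, so the step subtracts
  \<open>2 * \<eta>\<close> times \<open>R W ** transpose A ** A\<close> from the residual; expand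
  the squared norm.\<close>

lemma loss_gradient_step:
  fixes \<phi> :: "'t \<Rightarrow> 'x \<Rightarrow> real ^ 'd" and x :: "'n::finite \<Rightarrow> 'x" and \<theta> :: 't
    and y :: "'n \<Rightarrow> real ^ 'o"
  defines "A \<equiv> feature_matrix \<phi> x \<theta>"
  defines "R \<equiv> \<lambda>W. W ** A - label_matrix y"
  shows "loss \<phi> x y W \<theta> - loss \<phi> x y (W - \<eta> *\<^sub>R gradient (\<lambda>W. loss \<phi> x y W \<theta>) W) \<theta> =
    4 * \<eta> * (R W \<bullet> (R W ** transpose A ** A)) -
    4 * \<eta>\<^sup>2 * (norm (R W ** transpose A ** A))\<^sup>2"
proof -
  let ?R = "R W"
  let ?N = "?R ** transpose A ** A"
  have L: "loss \<phi> x y W' \<theta> = (norm (R W'))\<^sup>2" for W'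
    unfolding loss_eq_frobenius A_def R_def by (simp only: norm_minus_commute)
  note lin = bounded_linear.linear[OF bounded_linear_matrix_mult_left[of A]]
  have "(W - \<eta> *\<^sub>R gradient (\<lambda>W. loss \<phi> x y W \<theta>) W) ** A = W ** A - (2 * \<eta>) *\<^sub>R ?N"
    unfolding gradient_loss linear_diff[OF lin] linear_scale[OF lin]
    by (simp add: A_def R_def linear_scale[OF lin, unfolded A_def] mult.commute)
  then have step: "R (W - \<eta> *\<^sub>R gradient (\<lambda>W. loss \<phi> x y W \<theta>) W) = ?R - (2 * \<eta>) *\<^sub>R ?N"
    by (simp add: R_def)
  then show ?thesis
    unfolding L[of W] L[of "W - _"] step power2_norm_eq_inner
    by (simp add: inner_diff_left inner_diff_right inner_commute[of ?N ?R] algebra_simps power2_eq_square)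
qed

text \<open>A gradient step from a minimizer cannot gain, however small the step.\<close>

lemma loss_minimizer_normal_equation:
  fixes \<phi> :: "'t \<Rightarrow> 'x \<Rightarrow> real ^ 'd" and y :: "'n::finite \<Rightarrow> real ^ 'o"
  assumes min: "is_arg_min (\<lambda>W. loss \<phi> x y W \<theta>) (\<lambda>_. True) W"
  shows "(W ** feature_matrix \<phi> x \<theta> - label_matrix y) ** transpose (feature_matrix \<phi> x \<theta>) = 0"
proof -
  define A where "A = feature_matrix \<phi> x \<theta>"
  define R where "R = W ** A - label_matrix y"
  have "4 * (norm (R ** transpose A))\<^sup>2 \<le> 0"
  proof (rule linear_le_quadratic_imp_nonpos)
    fix t :: real assume "t > 0"
    let ?W = "W - t *\<^sub>R gradient (\<lambda>W. loss \<phi> x y W \<theta>) W"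
    have "loss \<phi> x y W \<theta> - loss \<phi> x y ?W \<theta> \<le> 0"
      using min by (simp add: is_arg_min_def not_less)
    then show "4 * (norm (R ** transpose A))\<^sup>2 * t \<le> 4 * (norm (R ** transpose A ** A))\<^sup>2 * t\<^sup>2"
      using loss_gradient_step[of \<phi> x y W \<theta> t]
      by (simp add: inner_gradient_direction mult_ac flip: A_def R_def)
  qed
  then show ?thesis
    by (simp flip: A_def R_def)
qed

text \<open>If \<open>A *v b = 0\<close>, every residual sends \<open>b\<close> to
  \<open>- (label_matrix y *v b)\<close>, and the terms cancel. Otherwise \<open>b\<close> is a
  multiple of \<open>transpose A *v (A *v b)\<close>, which the residual of a minimizer kills by the
  normal equation.\<close>

lemma loss_minimizer_gap:
  fixes \<phi> :: "'t \<Rightarrow> 'x \<Rightarrow> real ^ 'd" and x :: "'n::finite \<Rightarrow> 'x" and \<theta> :: 't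
    and y :: "'n \<Rightarrow> real ^ 'o"
  defines "A \<equiv> feature_matrix \<phi> x \<theta>"
  defines "R \<equiv> \<lambda>W. W ** A - label_matrix y"
  assumes B: "orthonormal_basis B"
    and ev: "\<And>b. b \<in> B \<Longrightarrow> (transpose A ** A) *v b = (norm (A *v b))\<^sup>2 *\<^sub>R b"
    and min: "is_arg_min (\<lambda>W. loss \<phi> x y W \<theta>) (\<lambda>_. True) W'"
  shows "loss \<phi> x y W \<theta> - loss \<phi> x y W' \<theta> =
    (\<Sum>b | b \<in> B \<and> A *v b \<noteq> 0. (norm (R W *v b))\<^sup>2)"
proof -
  have L: "loss \<phi> x y W \<theta> = (\<Sum>b\<in>B. (norm (R W *v b))\<^sup>2)" for W
  proof -
    have "loss \<phi> x y W \<theta> = (norm (R W))\<^sup>2"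
      unfolding loss_eq_frobenius A_def R_def by (simp only: norm_minus_commute)
    then show ?thesis
      by (simp only: power2_norm_eq_inner inner_matrix_orthonormal_basis[OF B])
  qed
  have ne: "R W' ** transpose A = 0"
    unfolding A_def R_def by (rule loss_minimizer_normal_equation[OF min])
  have diff: "(norm (R W *v b))\<^sup>2 - (norm (R W' *v b))\<^sup>2 =
      (if A *v b \<noteq> 0 then (norm (R W *v b))\<^sup>2 else 0)" if b: "b \<in> B" for b
  proof (cases "A *v b = 0")
    case True
    have "R V *v b = - (label_matrix y *v b)" for V
      by (simp add: R_def matrix_vector_mult_diff_rdistrib True flip: matrix_vector_mul_assoc)
    then show ?thesis
      using True by simp
  next
    case False
    have "(norm (A *v b))\<^sup>2 *\<^sub>R (R W' *v b) = R W' *v ((transpose A ** A) *v b)"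
      unfolding ev[OF b] by (simp add: matrix_vector_mult_scaleR)
    also have "\<dots> = (R W' ** transpose A) *v (A *v b)"
      by (simp only: matrix_vector_mul_assoc matrix_mul_assoc)
    also have "\<dots> = 0"
      by (simp add: ne)
    finally show ?thesis
      using False by simp
  qed
  show ?thesis
    unfolding L using orthonormal_basis_finite[OF B]
    by (simp add: diff sum.inter_filter flip: sum_subtractf)
qed

section \<open>Moments and scalar inequalities\<close>

text \<open>Summing over \<open>b\<close> rather than over the values of \<open>g\<close> avoids
  grouping repeated singular values.\<close>

lemma expectation_map_pmf_finite:
  fixes f :: "real \<Rightarrow> real"
  assumes "finite B" and Q: "\<And>b. pmf Q b = (if b \<in> B then c b / M else 0)"
  shows "measure_pmf.expectation (map_pmf g Q) f = (\<Sum>b\<in>B. c b * f (g b)) / M"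
proof -
  have "measure_pmf.expectation Q (\<lambda>b. f (g b)) = (\<Sum>b\<in>B. pmf Q b *\<^sub>R f (g b))"
    by (rule integral_measure_pmf[OF assms(1)]) (simp add: set_pmf_iff Q split: if_splits)
  then show ?thesis
    by (simp add: Q sum_divide_distrib)
qed

text \<open>Completing the square: the right side is the gain at the best rate
  \<open>\<eta> = S1 / (2 * S2)\<close>, which makes the final bound uniform in
  \<open>\<eta>\<close>.\<close>

lemma quadratic_gain_le_ratio:
  fixes S1 S2 \<eta> :: real
  assumes "S2 > 0"
  shows "4 * \<eta> * S1 - 4 * \<eta>\<^sup>2 * S2 \<le> S1\<^sup>2 / S2"
proof -
  have "0 \<le> (S1 - 2 * \<eta> * S2)\<^sup>2"
    by simp
  also have "\<dots> = S1\<^sup>2 - S2 * (4 * \<eta> * S1 - 4 * \<eta>\<^sup>2 * S2)"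
    by (simp add: power2_eq_square algebra_simps)
  finally show ?thesis
    using assms by (simp add: pos_le_divide_eq mult.commute)
qed

text \<open>Applied with \<open>e1\<close> and \<open>e2\<close> the means of
  \<open>\<sigma>\<^sup>2\<close> and of its square, so that \<open>e2 - e1\<^sup>2\<close> is the
  variance.\<close>

lemma variation_bound_eq:
  fixes e1 e2 :: real
  assumes "e1 > 0" "e2 > 0"
  shows "inverse (1 + (e2 - e1\<^sup>2) / e1\<^sup>2) = e1\<^sup>2 / e2"
  using assms by (simp add: field_simps)

section \<open>The distribution on the singular values, its bound and its SVD formula\<close>

theorem theorem5p3:
  fixes \<Theta> :: "(real ^ 'p) set"
    and \<phi> :: "real ^ 'p \<Rightarrow> 'x \<Rightarrow> real ^ 'd"
    and x :: "'n::finite \<Rightarrow> 'x"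
    and y :: "'n \<Rightarrow> real ^ 'o"
    and W :: "real ^ 'd ^ 'o"
    and \<theta> :: "real ^ 'p"
  assumes "\<theta> \<in> \<Theta>"
    and "\<not> is_arg_min (\<lambda>W'. loss \<phi> x y W' \<theta>) (\<lambda>_. True) W"
  shows "\<exists>P :: real pmf.
    finite (set_pmf P) \<and>
    set_pmf P \<subseteq> nonzero_singular_values (feature_matrix \<phi> x \<theta>) \<and>
    (\<forall>\<eta>>0. \<forall>W_CF. is_arg_min (\<lambda>W'. loss \<phi> x y W' \<theta>) (\<lambda>_. True) W_CF \<longrightarrow>
      (let W_GD = W - \<eta> *\<^sub>R gradient (\<lambda>W'. loss \<phi> x y W' \<theta>) W;
           bound = inverse (1 + measure_pmf.variance P (\<lambda>\<sigma>. \<sigma>\<^sup>2) /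
                                (measure_pmf.expectation P (\<lambda>\<sigma>. \<sigma>\<^sup>2))\<^sup>2)
       in (loss \<phi> x y W \<theta> - loss \<phi> x y W_GD \<theta>) / (loss \<phi> x y W \<theta> - loss \<phi> x y W_CF \<theta>) \<le> bound
          \<and> bound \<le> 1)) \<and>
    (\<forall>(U :: real ^ 'r ^ 'd) (S :: real ^ 'r ^ 'r) (V :: real ^ 'r ^ 'n).
      compact_svd (feature_matrix \<phi> x \<theta>) U S V \<and> inj (\<lambda>i. S $ i $ i) \<longrightarrow>
      (\<forall>i. pmf P (S $ i $ i) =
        (norm (column i ((W ** feature_matrix \<phi> x \<theta> - label_matrix y) ** V)))\<^sup>2 /
        (norm ((W ** feature_matrix \<phi> x \<theta> - label_matrix y) ** V))\<^sup>2))"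
proof -
  define A where "A = feature_matrix \<phi> x \<theta>"
  define R where "R = W ** A - label_matrix y"
  obtain B where B: "orthonormal_basis B"
    and ev: "\<And>b. b \<in> B \<Longrightarrow> (transpose A ** A) *v b = (norm (A *v b))\<^sup>2 *\<^sub>R b"
    by (rule right_singular_basis_exists[of A]) blast
  note finB = orthonormal_basis_finite[OF B]
  define Bp where "Bp = {b \<in> B. A *v b \<noteq> 0}"
  have finBp: "finite Bp" and BpB: "Bp \<subseteq> B"
    using finB by (auto simp: Bp_def)
  define \<sigma> where "\<sigma> b = norm (A *v b)" for b
  define c where "c b = (norm (R *v b))\<^sup>2" for b
  define M where "M = sum c Bp"
  have gap: "loss \<phi> x y W \<theta> - loss \<phi> x y W' \<theta> = M"
    if "is_arg_min (\<lambda>W'. loss \<phi> x y W' \<theta>) (\<lambda>_. True) W'" for W'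
    using loss_minimizer_gap[OF B ev[unfolded A_def] that, of W]
    by (simp add: M_def c_def Bp_def R_def A_def)
  \<comment> \<open>Here the non-optimality of \<open>W\<close> enters: \<open>M\<close> is its gap
    to a minimizer.\<close>
  have "M > 0"
  proof -
    obtain W' where W': "is_arg_min (\<lambda>W'. loss \<phi> x y W' \<theta>) (\<lambda>_. True) W'"
      using loss_minimizer_exists[of \<phi> x y \<theta>] by blast
    then have "loss \<phi> x y W' \<theta> < loss \<phi> x y W \<theta>"
      using assms(2) unfolding is_arg_min_def by (metis not_less order_trans)
    then show ?thesis
      using gap[OF W'] by simp
  qed
  obtain Q where Q: "\<And>b. pmf Q b = (if b \<in> Bp then c b / M else 0)"
  proof (rule pmf_of_weights_exists[OF finBp])
    show "c b / M \<ge> 0" for b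
      using \<open>M > 0\<close> by (simp add: c_def)
    show "(\<Sum>b\<in>Bp. c b / M) = 1"
      using \<open>M > 0\<close> by (simp add: M_def flip: sum_divide_distrib)
  qed blast
  \<comment> \<open>Basis vectors sharing a singular value have their weights merged. Neither
    \<open>\<eta>\<close> nor a minimizer enters, so one \<open>P\<close> serves all of
    them.\<close>
  define P where "P = map_pmf \<sigma> Q"
  \<comment> \<open>Only an inclusion, since \<open>c b\<close> may vanish on
    \<open>Bp\<close>.\<close>
  have setQ: "set_pmf Q \<subseteq> Bp"
    by (auto simp: set_pmf_iff Q split: if_splits)
  have finP: "finite (set_pmf P)"
    using finite_subset[OF setQ finBp] by (simp add: P_def)
  have nsv: "nonzero_singular_values A = \<sigma> ` Bp"
    unfolding \<sigma>_def Bp_def by (rule nonzero_singular_values_basis[OF B ev])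
  have setP: "set_pmf P \<subseteq> nonzero_singular_values A"
    using setQ by (auto simp: P_def nsv)
  define S1 where "S1 = (\<Sum>b\<in>Bp. c b * (\<sigma> b)\<^sup>2)"
  define S2 where "S2 = (\<Sum>b\<in>Bp. c b * ((\<sigma> b)\<^sup>2)\<^sup>2)"
  obtain b0 where b0: "b0 \<in> Bp" "c b0 > 0"
    using \<open>M > 0\<close> unfolding M_def by (metis not_less sum_nonpos)
  have S1: "S1 > 0" and S2: "S2 > 0"
  proof -
    have "c b \<ge> 0" for b
      by (simp add: c_def)
    moreover have "\<sigma> b0 \<noteq> 0"
      using b0(1) by (simp add: \<sigma>_def Bp_def)
    ultimately show "S1 > 0" "S2 > 0"
      unfolding S1_def S2_def using b0(2) by (auto intro!: sum_pos2[OF finBp b0(1)])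
  qed
  \<comment> \<open>\<open>R ** transpose A ** A\<close> rescales \<open>R *v b\<close> by
    \<open>(\<sigma> b)\<^sup>2\<close>, which turns the two coefficients of the step into
    \<open>S1\<close> and \<open>S2\<close>.\<close>
  have N: "(R ** transpose A ** A) *v b = (\<sigma> b)\<^sup>2 *\<^sub>R (R *v b)" if "b \<in> B" for b
  proof -
    have "(R ** transpose A ** A) *v b = R *v ((transpose A ** A) *v b)"
      by (simp only: matrix_vector_mul_assoc matrix_mul_assoc)
    then show ?thesis
      by (simp add: ev[OF that] \<sigma>_def matrix_vector_mult_scaleR)
  qed
  have \<sigma>0: "\<sigma> b = 0" if "b \<in> B - Bp" for b
    using that by (simp add: \<sigma>_def Bp_def)
  have "R \<bullet> (R ** transpose A ** A) = (\<Sum>b\<in>B. c b * (\<sigma> b)\<^sup>2)"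
    unfolding inner_matrix_orthonormal_basis[OF B]
    by (intro sum.cong) (simp_all add: N c_def power2_norm_eq_inner)
  also have "\<dots> = S1"
    unfolding S1_def using \<sigma>0 by (intro sum.mono_neutral_right finB BpB) auto
  finally have E1: "R \<bullet> (R ** transpose A ** A) = S1" .
  have "(norm (R ** transpose A ** A))\<^sup>2 = (\<Sum>b\<in>B. c b * ((\<sigma> b)\<^sup>2)\<^sup>2)"
    unfolding power2_norm_eq_inner[of "R ** _ ** _"] inner_matrix_orthonormal_basis[OF B]
    by (intro sum.cong) (simp_all add: N c_def dot_square_norm power2_eq_square)
  also have "\<dots> = S2"
    unfolding S2_def using \<sigma>0 by (intro sum.mono_neutral_right finB BpB) auto
  finally have E2: "(norm (R ** transpose A ** A))\<^sup>2 = S2" .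
  have step: "loss \<phi> x y W \<theta> - loss \<phi> x y (W - \<eta> *\<^sub>R gradient (\<lambda>W'. loss \<phi> x y W' \<theta>) W) \<theta> =
      4 * \<eta> * S1 - 4 * \<eta>\<^sup>2 * S2" for \<eta>
    unfolding E1[symmetric] E2[symmetric] R_def A_def by (rule loss_gradient_step)
  have e1: "measure_pmf.expectation P (\<lambda>\<sigma>. \<sigma>\<^sup>2) = S1 / M"
    unfolding P_def S1_def by (rule expectation_map_pmf_finite[OF finBp Q])
  have e2: "measure_pmf.expectation P (\<lambda>\<sigma>. (\<sigma>\<^sup>2)\<^sup>2) = S2 / M"
    unfolding P_def S2_def by (rule expectation_map_pmf_finite[OF finBp Q])
  have var: "measure_pmf.variance P (\<lambda>\<sigma>. \<sigma>\<^sup>2) = S2 / M - (S1 / M)\<^sup>2"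
    by (subst measure_pmf.variance_eq) (simp_all only: integrable_measure_pmf_finite[OF finP] e1 e2)
  \<comment> \<open>The form with denominator \<open>M\<close>, the gap to any minimizer, leaves
    only the numerators to be compared.\<close>
  have bound: "inverse (1 + measure_pmf.variance P (\<lambda>\<sigma>. \<sigma>\<^sup>2) /
      (measure_pmf.expectation P (\<lambda>\<sigma>. \<sigma>\<^sup>2))\<^sup>2) = (S1\<^sup>2 / S2) / M"
  proof -
    have "inverse (1 + (S2 / M - (S1 / M)\<^sup>2) / (S1 / M)\<^sup>2) = (S1 / M)\<^sup>2 / (S2 / M)"
      using S1 S2 \<open>M > 0\<close> by (intro variation_bound_eq) auto
    also have "\<dots> = (S1\<^sup>2 / S2) / M"
      using S2 \<open>M > 0\<close> by (simp add: power2_eq_square field_simps)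
    finally show ?thesis
      unfolding var unfolding e1 .
  qed
  have "0 \<le> measure_pmf.variance P (\<lambda>\<sigma>. \<sigma>\<^sup>2)"
    by (rule measure_pmf.variance_positive)
  then have le1: "inverse (1 + measure_pmf.variance P (\<lambda>\<sigma>. \<sigma>\<^sup>2) /
      (measure_pmf.expectation P (\<lambda>\<sigma>. \<sigma>\<^sup>2))\<^sup>2) \<le> 1"
    by (intro inverse_le_1_iff[THEN iffD2] disjI2) simp
  have svd: "pmf P (S $ i $ i) = (norm (column i (R ** V)))\<^sup>2 / (norm (R ** V))\<^sup>2"
    if svd: "compact_svd A U S V" and inj: "inj (\<lambda>i. S $ i $ i)"
    for U :: "real ^ 'r ^ 'd" and S :: "real ^ 'r ^ 'r" and V :: "real ^ 'r ^ 'n" and i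
  proof -
    note nsvS = nonzero_singular_values_svd[OF svd]
    have pmfP: "pmf P (S $ i $ i) = (norm (column i (R ** V)))\<^sup>2 / M" for i
    proof -
      have col: "\<exists>a. \<bar>a\<bar> = 1 \<and> b = a *\<^sub>R column i V" if "b \<in> Bp" "\<sigma> b = S $ i $ i" for b
      proof -
        have "norm b = 1"
          using that BpB B by (auto simp: orthonormal_basis_def)
        moreover have "(transpose A ** A) *v b = (S $ i $ i)\<^sup>2 *\<^sub>R b"
          using ev[of b] that BpB by (auto simp: \<sigma>_def)
        ultimately show ?thesis
          by (rule compact_svd_unit_eigenvector[OF svd inj]) blast
      qed
      have "S $ i $ i \<in> \<sigma> ` Bp"
        unfolding nsv[symmetric] nsvS by (rule rangeI)
      then obtain b where b: "b \<in> Bp" "\<sigma> b = S $ i $ i"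
        by auto
      then obtain a where a: "\<bar>a\<bar> = 1" "b = a *\<^sub>R column i V"
        using col by blast
      \<comment> \<open>Two such vectors would be multiples of the same column, yet distinct members
        of \<open>B\<close> are orthogonal unit vectors.\<close>
      have uniq: "b' = b" if b': "b' \<in> Bp" "\<sigma> b' = S $ i $ i" for b'
      proof (rule ccontr)
        assume "b' \<noteq> b"
        then have "b' \<bullet> b = 0"
          using subsetD[OF BpB b'(1)] subsetD[OF BpB b(1)] B by (auto simp: orthonormal_basis_def pairwise_def orthogonal_def)
        moreover obtain a' where a': "\<bar>a'\<bar> = 1" "b' = a' *\<^sub>R column i V"
          using col[OF b'] by blast
        moreover have "norm b = 1"
          using subsetD[OF BpB b(1)] B by (simp add: orthonormal_basis_def)
        ultimately show False
          using a by auto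
      qed
      \<comment> \<open>Intersecting with the support discards the vectors outside \<open>Bp\<close>
        on which \<open>\<sigma>\<close> takes the same value.\<close>
      have "pmf P (S $ i $ i) = measure Q (\<sigma> -` {S $ i $ i} \<inter> set_pmf Q)"
        by (simp add: P_def pmf_map measure_Int_set_pmf)
      also have "\<sigma> -` {S $ i $ i} \<inter> set_pmf Q = {b} \<inter> set_pmf Q"
        using b uniq setQ by blast
      also have "measure Q \<dots> = pmf Q b"
        by (simp add: measure_Int_set_pmf measure_pmf_single)
      also have "\<dots> = c b / M"
        using b by (simp add: Q)
      also have "c b = (norm (column i (R ** V)))\<^sup>2"
        using a by (simp add: c_def column_matrix_mult matrix_vector_mult_scaleR)
      finally show ?thesis .
    qed
    \<comment> \<open>The masses on the diagonal of \<open>S\<close> exhaust \<open>P\<close>; that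
      they sum to 1 identifies \<open>M\<close> with \<open>(norm (R ** V))\<^sup>2\<close>.\<close>
    have "1 = (\<Sum>s\<in>range (\<lambda>i. S $ i $ i). pmf P s)"
      using setP nsvS by (intro sum_pmf_eq_1[symmetric]) auto
    also have "\<dots> = (\<Sum>i\<in>UNIV. pmf P (S $ i $ i))"
      by (rule sum.reindex[OF inj, unfolded o_def])
    also have "\<dots> = (norm (R ** V))\<^sup>2 / M"
      by (simp add: pmfP norm_power2_eq_sum_columns[of "R ** V"] flip: sum_divide_distrib)
    finally have "(norm (R ** V))\<^sup>2 = M"
      using \<open>M > 0\<close> by simp
    then show ?thesis
      by (simp add: pmfP)
  qed
  show ?thesis
    unfolding Let_def
  proof (intro exI[of _ P] conjI allI impI)
    show "finite (set_pmf P)" "set_pmf P \<subseteq> nonzero_singular_values (feature_matrix \<phi> x \<theta>)"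
      using finP setP by (simp_all add: A_def)
  next
    fix \<eta> :: real and W_CF
    assume "is_arg_min (\<lambda>W'. loss \<phi> x y W' \<theta>) (\<lambda>_. True) W_CF"
    note gap[OF this]
    then show "(loss \<phi> x y W \<theta> - loss \<phi> x y (W - \<eta> *\<^sub>R gradient (\<lambda>W'. loss \<phi> x y W' \<theta>) W) \<theta>) /
        (loss \<phi> x y W \<theta> - loss \<phi> x y W_CF \<theta>) \<le>
        inverse (1 + measure_pmf.variance P (\<lambda>\<sigma>. \<sigma>\<^sup>2) /
          (measure_pmf.expectation P (\<lambda>\<sigma>. \<sigma>\<^sup>2))\<^sup>2)"
      unfolding bound step
      using quadratic_gain_le_ratio[OF S2, of \<eta> S1] \<open>M > 0\<close>
      by (simp only: divide_right_mono less_imp_le)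
  qed (use le1 svd in \<open>auto simp: A_def R_def\<close>)
qed

end
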